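(* Let $G,H$ be finite abstract simplicial complexes and let $G+H$ be their join. Then the extended $f$-vector generating functions satisfy $$f_{G+H}=f_G\, f_H .$$
   Context: A finite abstract simplicial complex is a finite set of non-empty finite sets (simplices) closed under taking non-empty subsets; a simplex $x$ has dimension $|x|-1$. For complexes $G,H$ on disjoint vertex sets, the join $G+H$ has as simplices the simplices of $G$, the simplices of $H$, and all unions $x\cup y$ with $x\in G$, $y\in H$. (For Whitney complexes of graphs this is the Whitney complex of the Zykov join graph: the disjoint union of the two graphs with all edges between them added.) If $G$ has $v_k$ simplices of dimension $k$, then $f_G(x)=1+\sum_{k\ge 0} v_k x^{k+1}$; the empty complex has $f=1$. *)

theory Defs
  imports "HOL-Computational_Algebra.Polynomial"
begin

definition abstract_simplicial_complex :: "'a set set \<Rightarrow> bool" where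
  "abstract_simplicial_complex G \<longleftrightarrow>
     finite G \<and> (\<forall>x\<in>G. finite x \<and> x \<noteq> {}) \<and>
     (\<forall>x\<in>G. \<forall>y. y \<subseteq> x \<and> y \<noteq> {} \<longrightarrow> y \<in> G)"

definition vertices :: "'a set set \<Rightarrow> 'a set" where
  "vertices G = \<Union>G"

(* Simplices are non-empty, so the subtraction on nat does not truncate. *)
definition simplex_dim :: "'a set \<Rightarrow> nat" where
  "simplex_dim x = card x - 1"

definition f_number :: "'a set set \<Rightarrow> nat \<Rightarrow> nat" where
  "f_number G k = card {x \<in> G. simplex_dim x = k}"

(* The sum ranges over the dimensions that occur in G; for every other k the
   coefficient f_number G k is 0, so this is the sum over all k \<ge> 0. *)
definition f_function :: "'a set set \<Rightarrow> int poly" where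
  "f_function G = 1 + (\<Sum>k \<in> simplex_dim ` G. monom (int (f_number G k)) (k + 1))"

(* Meaningful as the join only when the vertex sets of G and H are disjoint. *)
definition complex_join :: "'a set set \<Rightarrow> 'a set set \<Rightarrow> 'a set set" where
  "complex_join G H = G \<union> H \<union> {x \<union> y | x y. x \<in> G \<and> y \<in> H}"

lemma complex_join_cases:
  assumes "z \<in> complex_join G H"
  obtains "z \<in> G" | "z \<in> H" | x y where "z = x \<union> y" "x \<in> G" "y \<in> H"
  using assms unfolding complex_join_def Un_iff mem_Collect_eq by (elim disjE exE conjE)

lemma abstract_simplicial_complex_join:
  assumes G: "abstract_simplicial_complex G" and H: "abstract_simplicial_complex H"
  shows "abstract_simplicial_complex (complex_join G H)"
proof -
  have finG: "finite G" and sG: "\<And>x. x \<in> G \<Longrightarrow> finite x \<and> x \<noteq> {}"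
    and faceG: "\<And>x y. x \<in> G \<Longrightarrow> y \<subseteq> x \<Longrightarrow> y \<noteq> {} \<Longrightarrow> y \<in> G"
    using G unfolding abstract_simplicial_complex_def by blast+
  have finH: "finite H" and sH: "\<And>x. x \<in> H \<Longrightarrow> finite x \<and> x \<noteq> {}"
    and faceH: "\<And>x y. x \<in> H \<Longrightarrow> y \<subseteq> x \<Longrightarrow> y \<noteq> {} \<Longrightarrow> y \<in> H"
    using H unfolding abstract_simplicial_complex_def by blast+
  have "complex_join G H \<subseteq> G \<union> H \<union> (\<lambda>(x, y). x \<union> y) ` (G \<times> H)"
    unfolding complex_join_def by auto
  moreover have "finite (G \<union> H \<union> (\<lambda>(x, y). x \<union> y) ` (G \<times> H))"
    by (intro finite_UnI finite_imageI finite_cartesian_product finG finH)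
  ultimately have fin: "finite (complex_join G H)"
    by (rule finite_subset)
  have simplex: "finite z \<and> z \<noteq> {}" if "z \<in> complex_join G H" for z
  proof -
    from that show ?thesis
    proof (cases rule: complex_join_cases)
      case 1
      then show ?thesis by (rule sG)
    next
      case 2
      then show ?thesis by (rule sH)
    next
      case 3
      show ?thesis using 3(1) sG[OF 3(2)] sH[OF 3(3)] by simp
    qed
  qed
  have face: "w \<in> complex_join G H"
    if z: "z \<in> complex_join G H" and w: "w \<subseteq> z" "w \<noteq> {}" for z w
  proof -
    from z show ?thesis
    proof (cases rule: complex_join_cases)
      case 1
      then show ?thesis using faceG[OF _ w] by (simp add: complex_join_def)
    next
      case 2
      then show ?thesis using faceH[OF _ w] by (simp add: complex_join_def)
    next
      case (3 x y)
      have eq: "w = (w \<inter> x) \<union> (w \<inter> y)" using w(1) 3(1) by blast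
      show ?thesis
      proof (cases "w \<inter> x = {}")
        case True
        then have "w = w \<inter> y" using eq by simp
        then have "w \<in> H" using faceH[OF 3(3), of w] w(2) by blast
        then show ?thesis by (simp add: complex_join_def)
      next
        case wx: False
        have wxG: "w \<inter> x \<in> G" using faceG[OF 3(2) _ wx] by simp
        show ?thesis
        proof (cases "w \<inter> y = {}")
          case True
          then have "w = w \<inter> x" using eq by simp
          then have "w \<in> G" using wxG by simp
          then show ?thesis by (simp add: complex_join_def)
        next
          case False
          then have "w \<inter> y \<in> H" using faceH[OF 3(3) _ False] by simp
          then have "\<exists>a b. w = a \<union> b \<and> a \<in> G \<and> b \<in> H"
            using wxG eq by (intro exI[of _ "w \<inter> x"] exI[of _ "w \<inter> y"] conjI)
          then show ?thesis by (simp add: complex_join_def)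
        qed
      qed
    qed
  qed
  show ?thesis
    unfolding abstract_simplicial_complex_def
    using fin simplex face by blast
qed

end

theory Submission
  imports Defs
begin

text \<open>Once the empty simplex is adjoined, the constant term 1 becomes its contribution and
  \<open>f\<^sub>G\<close> is the sum of \<open>X ^ card x\<close> over all simplices \<open>x\<close>. Likewise the three kinds of simplices
  of the join become a single kind \<open>x \<union> y\<close>, with \<open>x\<close> and \<open>y\<close> determined by \<open>x \<union> y\<close>.\<close>

text \<open>Grouping the simplices by dimension collects \<open>f_number G k\<close> equal monomials
  of degree \<open>k + 1\<close>.\<close>

lemma f_function_eq_sum_monom:
  assumes "abstract_simplicial_complex G"
  shows "f_function G = (\<Sum>x\<in>insert {} G. monom 1 (card x))"
proof -
  have fin: "finite G" and simplex: "\<And>x. x \<in> G \<Longrightarrow> finite x \<and> x \<noteq> {}"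
    using assms by (auto simp: abstract_simplicial_complex_def)
  have card: "card x = simplex_dim x + 1" if "x \<in> G" for x
    using simplex[OF that] by (simp add: simplex_dim_def Suc_leI card_gt_0_iff)
  have "(\<Sum>x\<in>G. monom (1::int) (card x))
      = (\<Sum>k\<in>simplex_dim ` G. \<Sum>x | x \<in> G \<and> simplex_dim x = k. monom 1 (card x))"
    by (rule sum.image_gen[OF fin])
  also have "\<dots> = (\<Sum>k\<in>simplex_dim ` G. monom (int (f_number G k)) (k + 1))"
  proof (rule sum.cong[OF refl])
    fix k
    have "(\<Sum>x | x \<in> G \<and> simplex_dim x = k. monom (1::int) (card x))
        = (\<Sum>x | x \<in> G \<and> simplex_dim x = k. monom 1 (k + 1))"
      using card by (intro sum.cong) auto
    then show "(\<Sum>x | x \<in> G \<and> simplex_dim x = k. monom (1::int) (card x))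
        = monom (int (f_number G k)) (k + 1)"
      \<comment> \<open>\<open>of_nat_monom\<close> turns the number of equal summands into a
        monomial of degree 0, which \<open>mult_monom\<close> absorbs.\<close>
      by (simp add: f_number_def of_nat_monom mult_monom)
  qed
  \<comment> \<open>As simplices are non-empty, \<open>{}\<close> is a new index; its term
    \<open>monom 1 0\<close> is the constant 1.\<close>
  finally show ?thesis
    using fin simplex by (subst sum.insert) (auto simp: f_function_def)
qed

text \<open>Pairs with \<open>y = {}\<close> give \<open>G\<close>, those with \<open>x = {}\<close>
  give \<open>H\<close>, and \<open>({}, {})\<close> gives the empty simplex.\<close>

lemma insert_empty_complex_join:
  "insert {} (complex_join G H) = (\<lambda>(x, y). x \<union> y) ` (insert {} G \<times> insert {} H)"
  unfolding complex_join_def by (auto simp: image_iff)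

text \<open>Intersecting \<open>x \<union> y\<close> with \<open>\<Union>A\<close> recovers
  \<open>x\<close>, and with \<open>\<Union>B\<close> recovers \<open>y\<close>.\<close>

lemma inj_on_Un_disjoint:
  assumes "\<Union>A \<inter> \<Union>B = {}"
  shows "inj_on (\<lambda>(x, y). x \<union> y) (A \<times> B)"
proof (rule inj_onI, clarsimp)
  fix x y x' y'
  assume "x \<in> A" "y \<in> B" "x' \<in> A" "y' \<in> B" and eq: "x \<union> y = x' \<union> y'"
  then have "(x \<union> y) \<inter> \<Union>A = x" "(x' \<union> y') \<inter> \<Union>A = x'"
    "(x \<union> y) \<inter> \<Union>B = y" "(x' \<union> y') \<inter> \<Union>B = y'"
    using assms by blast+
  then show "x = x' \<and> y = y'"
    using eq by metis
qed

theorem proposition3: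
  fixes G H :: "'a set set"
  assumes "abstract_simplicial_complex G"
    and "abstract_simplicial_complex H"
    and "vertices G \<inter> vertices H = {}"
  shows "f_function (complex_join G H) = f_function G * f_function H"
proof -
  let ?G = "insert {} G" and ?H = "insert {} H"
  have disj: "\<Union>?G \<inter> \<Union>?H = {}"
    using assms(3) by (simp add: vertices_def)
  have finite: "finite x" if "x \<in> ?G \<union> ?H" for x
    using that assms(1,2) by (auto simp: abstract_simplicial_complex_def)
  \<comment> \<open>Additivity of the exponents is what splits each monomial of the join into a
    product.\<close>
  have card: "card (x \<union> y) = card x + card y" if "x \<in> ?G" "y \<in> ?H" for x y
    using that disj finite by (intro card_Un_disjoint) blast+
  have "f_function (complex_join G H)
      = (\<Sum>z\<in>(\<lambda>(x, y). x \<union> y) ` (?G \<times> ?H). monom 1 (card z))"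
    using f_function_eq_sum_monom[OF abstract_simplicial_complex_join[OF assms(1,2)]]
    by (simp only: insert_empty_complex_join)
  also have "\<dots> = (\<Sum>(x, y)\<in>?G \<times> ?H. monom 1 (card (x \<union> y)))"
    by (subst sum.reindex[OF inj_on_Un_disjoint[OF disj]]) (simp only: comp_def case_prod_unfold)
  also have "\<dots> = (\<Sum>(x, y)\<in>?G \<times> ?H. monom 1 (card x) * monom 1 (card y))"
    using card by (intro sum.cong) (auto simp: mult_monom)
  also have "\<dots> = f_function G * f_function H"
    by (simp only: f_function_eq_sum_monom[OF assms(1)] f_function_eq_sum_monom[OF assms(2)]
        sum_product sum.cartesian_product)
  finally show ?thesis .
qed

end
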